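(* Let $v\ge 2$. Suppose $M=M_1+M_2$, where $M$ is the incidence matrix of a symmetric $(v,k,\lambda)$ design and $M_i$ is the incidence matrix of a symmetric $(v,k_i,\lambda_i)$ design ($i=1,2$). Let $\sigma=(k_1-\lambda_1)(k_2-\lambda_2)-\frac{2k_1k_2}{v-1}+1$. If $v$ is even, then $\sigma$ is the square of an integer. If $v$ is odd and $\sigma\neq 0$, then \[(\sigma,\sigma)_p^{\binom{v-1}{2}}(\sigma,v)_p=\big(\sigma,(-1)^{(v-1)/2}v\big)_p=1\] for every odd prime $p$.
   Context: A symmetric $(v,k,\lambda)$ design has as incidence matrix a $v\times v$ matrix $M$ with entries in $\{0,1\}$, every row and every column containing exactly $k$ ones, such that $MM^{\top}=M^{\top}M=(k-\lambda)I_v+\lambda J_v$, where $I_v$ is the identity and $J_v$ the all-ones $v\times v$ matrix. For nonzero rationals $a,b$ and a prime $p$, the Hilbert symbol $(a,b)_p$ is $1$ if $ax^2+by^2=z^2$ has a solution $(x,y,z)\neq(0,0,0)$ in the $p$-adic numbers $\mathbb{Q}_p$, and $-1$ otherwise. *)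

theory Defs
  imports "Jordan_Normal_Form.Matrix" "HOL-Algebra.QuotRing"
    "HOL-Computational_Algebra.Primes"
begin

section \<open>Symmetric designs\<close>

definition symmetric_design_matrix :: "nat \<Rightarrow> nat \<Rightarrow> nat \<Rightarrow> int mat \<Rightarrow> bool" where
  "symmetric_design_matrix v k l M \<longleftrightarrow>
     M \<in> carrier_mat v v \<and>
     (\<forall>i<v. \<forall>j<v. M $$ (i, j) \<in> {0, 1}) \<and>
     (\<forall>i<v. card {j. j < v \<and> M $$ (i, j) = 1} = k) \<and>
     (\<forall>j<v. card {i. i < v \<and> M $$ (i, j) = 1} = k) \<and>
     M * transpose_mat M = (int k - int l) \<cdot>\<^sub>m 1\<^sub>m v + int l \<cdot>\<^sub>m mat v v (\<lambda>_. 1) \<and>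
     transpose_mat M * M = (int k - int l) \<cdot>\<^sub>m 1\<^sub>m v + int l \<cdot>\<^sub>m mat v v (\<lambda>_. 1)"


section \<open>The field of p-adic numbers\<close>

definition padic_val :: "nat \<Rightarrow> rat \<Rightarrow> int" where
  "padic_val p x = int (multiplicity (int p) (fst (quotient_of x)))
                 - int (multiplicity (int p) (snd (quotient_of x)))"

definition padic_norm :: "nat \<Rightarrow> rat \<Rightarrow> real" where
  "padic_norm p x = (if x = 0 then 0 else real p powi (- padic_val p x))"

definition padic_Cauchy :: "nat \<Rightarrow> (nat \<Rightarrow> rat) \<Rightarrow> bool" where
  "padic_Cauchy p X \<longleftrightarrow> (\<forall>e>0. \<exists>N. \<forall>m\<ge>N. \<forall>n\<ge>N. padic_norm p (X m - X n) < e)"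

definition padic_null_seqs :: "nat \<Rightarrow> (nat \<Rightarrow> rat) set" where
  "padic_null_seqs p = {X. (\<lambda>n. padic_norm p (X n)) \<longlonglongrightarrow> 0}"

definition padic_Cauchy_ring :: "nat \<Rightarrow> (nat \<Rightarrow> rat) ring" where
  "padic_Cauchy_ring p =
     \<lparr>carrier = {X. padic_Cauchy p X},
      mult = (\<lambda>X Y n. X n * Y n), one = (\<lambda>_. 1),
      zero = (\<lambda>_. 0), add = (\<lambda>X Y n. X n + Y n)\<rparr>"

text \<open>\<open>\<rat>\<^sub>p\<close> is the completion of \<open>\<rat>\<close> with respect to the \<open>p\<close>-adic absolute value: Cauchy
  sequences of rationals modulo null sequences. A rational number embeds as the class of the
  corresponding constant sequence.\<close>

definition padic_field :: "nat \<Rightarrow> (nat \<Rightarrow> rat) set ring" where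
  "padic_field p = padic_Cauchy_ring p Quot padic_null_seqs p"

definition padic_of_rat :: "nat \<Rightarrow> rat \<Rightarrow> (nat \<Rightarrow> rat) set" where
  "padic_of_rat p a = padic_null_seqs p +>\<^bsub>padic_Cauchy_ring p\<^esub> (\<lambda>_. a)"


section \<open>The Hilbert symbol\<close>

text \<open>Meaningful for prime \<open>p\<close> and nonzero rationals \<open>a\<close>, \<open>b\<close>.\<close>

definition hilbert_symbol :: "nat \<Rightarrow> rat \<Rightarrow> rat \<Rightarrow> int" where
  "hilbert_symbol p a b =
     (let K = padic_field p in
      if \<exists>x\<in>carrier K. \<exists>y\<in>carrier K. \<exists>z\<in>carrier K.
           (x, y, z) \<noteq> (\<zero>\<^bsub>K\<^esub>, \<zero>\<^bsub>K\<^esub>, \<zero>\<^bsub>K\<^esub>) \<and>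
           padic_of_rat p a \<otimes>\<^bsub>K\<^esub> x [^]\<^bsub>K\<^esub> (2::nat) \<oplus>\<^bsub>K\<^esub> padic_of_rat p b \<otimes>\<^bsub>K\<^esub> y [^]\<^bsub>K\<^esub> (2::nat)
             = z [^]\<^bsub>K\<^esub> (2::nat)
      then 1 else - 1)"


section \<open>Well-definedness of the p-adic field\<close>

lemma padic_val_frac:
  assumes p: "prime p" and ab: "a \<noteq> 0" "b \<noteq> 0"
  shows "padic_val p (of_int a / of_int b) = int (multiplicity (int p) a) - int (multiplicity (int p) b)"
proof -
  obtain c d where q: "quotient_of (of_int a / of_int b) = (c, d)" by (cases "quotient_of (of_int a / of_int b)")
  have d: "d > 0" by (rule quotient_of_denom_pos[OF q])
  have eq: "(of_int a / of_int b :: rat) = of_int c / of_int d" by (rule quotient_of_div[OF q])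
  hence "(of_int (a * d) :: rat) = of_int (c * b)" using ab d by (simp add: field_simps)
  hence e: "a * d = c * b" by (simp only: of_int_eq_iff)
  hence c: "c \<noteq> 0" using ab d by auto
  have pe: "prime_elem (int p)" using p by simp
  have "multiplicity (int p) a + multiplicity (int p) d = multiplicity (int p) c + multiplicity (int p) b"
    using e ab c d
      prime_elem_multiplicity_mult_distrib[OF pe, of a d] prime_elem_multiplicity_mult_distrib[OF pe, of c b] by simp
  thus ?thesis unfolding padic_val_def q by simp
qed

lemma rat_fraction:
  obtains a b where "x = (of_int a / of_int b :: rat)" "b \<noteq> 0"
proof (cases x)
  case (Fract a b)
  thus thesis using that[of a b] by (simp add: Fract_of_int_quotient)
qed

lemma padic_norm_0 [simp]: "padic_norm p 0 = 0"
  by (simp add: padic_norm_def)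

lemma padic_norm_nonneg [simp]: "padic_norm p x \<ge> 0"
  by (simp add: padic_norm_def)

lemma padic_norm_eq_0_iff: "prime p \<Longrightarrow> padic_norm p x = 0 \<longleftrightarrow> x = 0"
  by (auto simp: padic_norm_def prime_gt_0_nat)

lemma padic_norm_1 [simp]: "padic_norm p 1 = 1"
  by (simp add: padic_norm_def padic_val_def)

lemma padic_norm_mult:
  assumes p: "prime p"
  shows "padic_norm p (x * y) = padic_norm p x * padic_norm p y"
proof (cases "x = 0 \<or> y = 0")
  case True thus ?thesis by auto
next
  case False
  obtain a b where x: "x = of_int a / of_int b" "b \<noteq> 0" by (rule rat_fraction)
  obtain c d where y: "y = of_int c / of_int d" "d \<noteq> 0" by (rule rat_fraction)
  have ac: "a \<noteq> 0" "c \<noteq> 0" using False x y by auto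
  have pe: "prime_elem (int p)" using p by simp
  have xy: "x * y = of_int (a * c) / of_int (b * d)" by (simp add: x y)
  have "padic_val p (x * y) = padic_val p x + padic_val p y"
    unfolding xy
    by (simp add: padic_val_frac[OF p] prime_elem_multiplicity_mult_distrib[OF pe] ac x y del: of_int_mult)
  thus ?thesis using False p
    by (simp add: padic_norm_def power_int_diff power_int_minus power_int_add divide_inverse prime_gt_0_nat)
qed

lemma padic_norm_minus: "prime p \<Longrightarrow> padic_norm p (- x) = padic_norm p x"
proof -
  assume p: "prime p"
  have "padic_norm p (-1) * padic_norm p (-1) = 1" by (simp flip: padic_norm_mult[OF p])
  hence "padic_norm p (-1) ^ 2 = 1" by (simp add: power2_eq_square)
  hence "padic_norm p (-1) = 1" using padic_norm_nonneg[of p "-1"] by (simp add: power2_eq_1_iff)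
  thus ?thesis using padic_norm_mult[OF p, of "-1" x] by simp
qed

lemma padic_norm_ultrametric:
  assumes p: "prime p"
  shows "padic_norm p (x + y) \<le> max (padic_norm p x) (padic_norm p y)"
proof (cases "x = 0 \<or> y = 0 \<or> x + y = 0")
  case True thus ?thesis by (auto simp: le_max_iff_disj)
next
  case False
  obtain a b where x: "x = of_int a / of_int b" "b \<noteq> 0" by (rule rat_fraction)
  obtain c d where y: "y = of_int c / of_int d" "d \<noteq> 0" by (rule rat_fraction)
  define A B N where "A = a * d" and "B = c * b" and "N = b * d"
  have N: "N \<noteq> 0" using x y by (simp add: N_def)
  have x': "x = of_int A / of_int N" and y': "y = of_int B / of_int N"
    using x y by (auto simp: A_def B_def N_def)
  have xy: "x + y = of_int (A + B) / of_int N" by (simp add: x' y' add_divide_distrib)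
  have nz: "A \<noteq> 0" "B \<noteq> 0" "A + B \<noteq> 0" using False x' y' xy by auto
  define m where "m = min (multiplicity (int p) A) (multiplicity (int p) B)"
  have "int p ^ m dvd A + B" by (intro dvd_add multiplicity_dvd') (auto simp: m_def)
  hence "m \<le> multiplicity (int p) (A + B)"
    using nz p by (intro multiplicity_geI) (auto simp: not_prime_unit)
  hence v: "min (padic_val p x) (padic_val p y) \<le> padic_val p (x + y)"
    unfolding x' y' xy[unfolded x' y'] padic_val_frac[OF p nz(1) N] padic_val_frac[OF p nz(2) N]
      padic_val_frac[OF p nz(3) N] by (auto simp: m_def min_def split: if_splits)
  have mono: "real p powi (- j) \<le> real p powi (- i)" if "i \<le> j" for i j
    using that p by (intro power_int_increasing) (auto dest: prime_gt_0_nat)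
  show ?thesis using v False
    by (auto simp: padic_norm_def min_def le_max_iff_disj mono split: if_splits)
qed

lemma padic_norm_triangle: "prime p \<Longrightarrow> padic_norm p (x + y) \<le> padic_norm p x + padic_norm p y"
  using padic_norm_ultrametric[of p x y] padic_norm_nonneg[of p x] padic_norm_nonneg[of p y] by linarith

lemma padic_norm_diff: "prime p \<Longrightarrow> padic_norm p (x - y) \<le> padic_norm p x + padic_norm p y"
  using padic_norm_triangle[of p x "-y"] by (simp add: padic_norm_minus)

lemma padic_Cauchy_const [simp]: "padic_Cauchy p (\<lambda>_. a)"
  by (simp add: padic_Cauchy_def)

lemma padic_Cauchy_add:
  assumes p: "prime p" and "padic_Cauchy p X" "padic_Cauchy p Y"
  shows "padic_Cauchy p (\<lambda>n. X n + Y n)"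
  unfolding padic_Cauchy_def
proof (intro allI impI)
  fix e :: real assume "e > 0"
  then obtain N1 N2 where N1: "\<And>m n. m \<ge> N1 \<Longrightarrow> n \<ge> N1 \<Longrightarrow> padic_norm p (X m - X n) < e / 2"
    and N2: "\<And>m n. m \<ge> N2 \<Longrightarrow> n \<ge> N2 \<Longrightarrow> padic_norm p (Y m - Y n) < e / 2"
    using assms(2,3) unfolding padic_Cauchy_def by (meson half_gt_zero)
  have "padic_norm p (X m + Y m - (X n + Y n)) < e" if "m \<ge> max N1 N2" "n \<ge> max N1 N2" for m n
    using N1[of m n] N2[of m n] that padic_norm_triangle[OF p, of "X m - X n" "Y m - Y n"]
    by (simp add: algebra_simps)
  thus "\<exists>N. \<forall>m\<ge>N. \<forall>n\<ge>N. padic_norm p (X m + Y m - (X n + Y n)) < e" by blast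
qed

lemma padic_Cauchy_bounded:
  assumes p: "prime p" and "padic_Cauchy p X"
  obtains B where "B > 0" "\<And>n. padic_norm p (X n) \<le> B"
proof -
  obtain N where N: "\<And>m n. m \<ge> N \<Longrightarrow> n \<ge> N \<Longrightarrow> padic_norm p (X m - X n) < 1"
    using assms(2)[unfolded padic_Cauchy_def, rule_format, of 1] by auto
  define B where "B = 1 + (\<Sum>n\<le>N. padic_norm p (X n))"
  have 1: "padic_norm p (X n) \<le> (\<Sum>n\<le>N. padic_norm p (X n))" if "n \<le> N" for n
    using that by (intro member_le_sum) auto
  have "padic_norm p (X n) \<le> B" for n
  proof (cases "n \<le> N")
    case True thus ?thesis using 1 by (force simp: B_def)
  next
    case False
    thus ?thesis using N[of n N] 1[of N] padic_norm_triangle[OF p, of "X n - X N" "X N"] by (simp add: B_def)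
  qed
  moreover have "B > 0" unfolding B_def by (intro add_pos_nonneg sum_nonneg) auto
  ultimately show thesis using that by blast
qed

lemma padic_Cauchy_mult:
  assumes p: "prime p" and X: "padic_Cauchy p X" and Y: "padic_Cauchy p Y"
  shows "padic_Cauchy p (\<lambda>n. X n * Y n)"
  unfolding padic_Cauchy_def
proof (intro allI impI)
  fix e :: real assume e: "e > 0"
  obtain A where A: "A > 0" "\<And>n. padic_norm p (X n) \<le> A" by (rule padic_Cauchy_bounded[OF p X]) blast
  obtain B where B: "B > 0" "\<And>n. padic_norm p (Y n) \<le> B" by (rule padic_Cauchy_bounded[OF p Y]) blast
  have "e / (2 * A) > 0" "e / (2 * B) > 0" using e A B by auto
  then obtain N1 N2 where N1: "\<And>m n. m \<ge> N1 \<Longrightarrow> n \<ge> N1 \<Longrightarrow> padic_norm p (X m - X n) < e / (2 * B)"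
    and N2: "\<And>m n. m \<ge> N2 \<Longrightarrow> n \<ge> N2 \<Longrightarrow> padic_norm p (Y m - Y n) < e / (2 * A)"
    using X Y unfolding padic_Cauchy_def by meson
  have "padic_norm p (X m * Y m - X n * Y n) < e" if mn: "m \<ge> max N1 N2" "n \<ge> max N1 N2" for m n
  proof -
    have "X m * Y m - X n * Y n = X m * (Y m - Y n) + (X m - X n) * Y n" by (simp add: algebra_simps)
    hence "padic_norm p (X m * Y m - X n * Y n)
        \<le> padic_norm p (X m) * padic_norm p (Y m - Y n) + padic_norm p (X m - X n) * padic_norm p (Y n)"
      using padic_norm_triangle[OF p] by (metis padic_norm_mult[OF p])
    also have "\<dots> \<le> A * padic_norm p (Y m - Y n) + padic_norm p (X m - X n) * B"
      using A B by (intro add_mono mult_right_mono mult_left_mono) auto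
    also have "\<dots> < A * (e / (2 * A)) + (e / (2 * B)) * B"
      using A B N1 N2 mn by (intro add_strict_mono mult_strict_left_mono mult_strict_right_mono) auto
    also have "\<dots> = e" using A B by simp
    finally show ?thesis .
  qed
  thus "\<exists>N. \<forall>m\<ge>N. \<forall>n\<ge>N. padic_norm p (X m * Y m - X n * Y n) < e" by blast
qed

lemma padic_Cauchy_uminus:
  "prime p \<Longrightarrow> padic_Cauchy p X \<Longrightarrow> padic_Cauchy p (\<lambda>n. - X n)"
  using padic_Cauchy_mult[of p "\<lambda>_. -1" X] by simp

lemma padic_null_imp_Cauchy:
  assumes p: "prime p" and "X \<in> padic_null_seqs p"
  shows "padic_Cauchy p X"
  unfolding padic_Cauchy_def
proof (intro allI impI)
  fix e :: real assume "e > 0"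
  hence "\<forall>\<^sub>F n in sequentially. padic_norm p (X n) < e / 2"
    using assms(2) by (intro order_tendstoD(2)[of _ 0]) (auto simp: padic_null_seqs_def)
  then obtain N where N: "\<And>n. n \<ge> N \<Longrightarrow> padic_norm p (X n) < e / 2"
    by (auto simp: eventually_sequentially)
  have "padic_norm p (X m - X n) < e" if "m \<ge> N" "n \<ge> N" for m n
    using N[of m] N[of n] that padic_norm_diff[OF p, of "X m" "X n"] by simp
  thus "\<exists>N. \<forall>m\<ge>N. \<forall>n\<ge>N. padic_norm p (X m - X n) < e" by blast
qed

lemma padic_null_add:
  assumes "prime p" "X \<in> padic_null_seqs p" "Y \<in> padic_null_seqs p"
  shows "(\<lambda>n. X n + Y n) \<in> padic_null_seqs p"
proof -
  have "(\<lambda>n. padic_norm p (X n) + padic_norm p (Y n)) \<longlonglongrightarrow> 0 + 0"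
    using assms by (intro tendsto_add) (auto simp: padic_null_seqs_def)
  hence "(\<lambda>n. padic_norm p (X n) + padic_norm p (Y n)) \<longlonglongrightarrow> 0" by simp
  from tendsto_sandwich[OF _ _ tendsto_const this, of "\<lambda>n. padic_norm p (X n + Y n)"]
  show ?thesis by (simp add: padic_null_seqs_def padic_norm_triangle[OF assms(1)])
qed

lemma padic_null_mult:
  assumes p: "prime p" and "padic_Cauchy p X" "Y \<in> padic_null_seqs p"
  shows "(\<lambda>n. X n * Y n) \<in> padic_null_seqs p"
proof -
  obtain B where B: "B > 0" "\<And>n. padic_norm p (X n) \<le> B" by (rule padic_Cauchy_bounded[OF p assms(2)]) blast
  have "(\<lambda>n. B * padic_norm p (Y n)) \<longlonglongrightarrow> B * 0"
    using assms by (intro tendsto_mult tendsto_const) (auto simp: padic_null_seqs_def)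
  hence "(\<lambda>n. B * padic_norm p (Y n)) \<longlonglongrightarrow> 0" by simp
  from tendsto_sandwich[OF _ _ tendsto_const this, of "\<lambda>n. padic_norm p (X n * Y n)"]
  show ?thesis by (simp add: padic_null_seqs_def padic_norm_mult[OF p] B mult_right_mono)
qed

lemma cring_padic_Cauchy_ring:
  assumes p: "prime p"
  shows "cring (padic_Cauchy_ring p)"
proof (rule cringI)
  show "abelian_group (padic_Cauchy_ring p)"
  proof (rule abelian_groupI)
    fix X assume "X \<in> carrier (padic_Cauchy_ring p)"
    thus "\<exists>Y\<in>carrier (padic_Cauchy_ring p). Y \<oplus>\<^bsub>padic_Cauchy_ring p\<^esub> X = \<zero>\<^bsub>padic_Cauchy_ring p\<^esub>"
      by (intro bexI[of _ "\<lambda>n. - X n"]) (auto simp: padic_Cauchy_ring_def padic_Cauchy_uminus[OF p])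
  qed (auto simp: padic_Cauchy_ring_def padic_Cauchy_add[OF p] algebra_simps)
  show "Group.comm_monoid (padic_Cauchy_ring p)"
    by (rule comm_monoidI) (auto simp: padic_Cauchy_ring_def padic_Cauchy_mult[OF p] algebra_simps)
qed (auto simp: padic_Cauchy_ring_def algebra_simps)

lemma ideal_padic_null_seqs:
  assumes p: "prime p"
  shows "ideal (padic_null_seqs p) (padic_Cauchy_ring p)"
proof -
  interpret cring "padic_Cauchy_ring p" by (rule cring_padic_Cauchy_ring[OF p])
  let ?R = "padic_Cauchy_ring p"
  have minus: "(\<lambda>n. - X n) \<in> padic_null_seqs p" if "X \<in> padic_null_seqs p" for X
    using that by (simp add: padic_null_seqs_def padic_norm_minus[OF p])
  have inv: "inv\<^bsub>add_monoid ?R\<^esub> X = (\<lambda>n. - X n)" if "X \<in> carrier ?R" for X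
    using that unfolding a_inv_def[symmetric]
    by (intro minus_equality) (auto simp: padic_Cauchy_ring_def padic_Cauchy_uminus[OF p])
  have sub: "padic_null_seqs p \<subseteq> carrier ?R"
    by (auto simp: padic_Cauchy_ring_def padic_null_imp_Cauchy[OF p])
  show ?thesis
  proof (rule idealI)
    show "subgroup (padic_null_seqs p) (add_monoid ?R)"
    proof (rule subgroup.intro)
      show "inv\<^bsub>add_monoid ?R\<^esub> X \<in> padic_null_seqs p" if "X \<in> padic_null_seqs p" for X
        using that sub inv[of X] minus[of X] by auto
      show "\<one>\<^bsub>add_monoid ?R\<^esub> \<in> padic_null_seqs p"
        by (simp add: padic_Cauchy_ring_def padic_null_seqs_def)
      show "X \<otimes>\<^bsub>add_monoid ?R\<^esub> Y \<in> padic_null_seqs p"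
        if "X \<in> padic_null_seqs p" "Y \<in> padic_null_seqs p" for X Y
        using padic_null_add[OF p that] by (simp add: padic_Cauchy_ring_def)
    qed (use sub in auto)
  next
    fix Y X assume "Y \<in> padic_null_seqs p" "X \<in> carrier ?R"
    hence "(\<lambda>n. X n * Y n) \<in> padic_null_seqs p"
      using padic_null_mult[OF p] by (simp add: padic_Cauchy_ring_def)
    thus "X \<otimes>\<^bsub>?R\<^esub> Y \<in> padic_null_seqs p" "Y \<otimes>\<^bsub>?R\<^esub> X \<in> padic_null_seqs p"
      by (simp_all add: padic_Cauchy_ring_def mult.commute)
  qed (rule ring_axioms)
qed

lemma padic_Cauchy_nonnull_bounded_below:
  assumes p: "prime p" and X: "padic_Cauchy p X" and nn: "X \<notin> padic_null_seqs p"
  obtains c N where "c > 0" "\<And>n. n \<ge> N \<Longrightarrow> padic_norm p (X n) \<ge> c"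
proof -
  have "\<not> (\<forall>e>0. \<exists>N. \<forall>n\<ge>N. padic_norm p (X n) < e)"
    using nn by (auto simp: padic_null_seqs_def LIMSEQ_iff)
  then obtain e where e: "e > 0" "\<And>N. \<exists>n\<ge>N. padic_norm p (X n) \<ge> e" by (meson not_less)
  obtain N where N: "\<And>m n. m \<ge> N \<Longrightarrow> n \<ge> N \<Longrightarrow> padic_norm p (X m - X n) < e / 2"
    using X e(1) unfolding padic_Cauchy_def by (meson half_gt_zero)
  obtain m where m: "m \<ge> N" "padic_norm p (X m) \<ge> e" using e(2) by blast
  have "padic_norm p (X n) \<ge> e / 2" if "n \<ge> N" for n
    using N[of m n] m that padic_norm_triangle[OF p, of "X m - X n" "X n"] by simp
  thus thesis using that[of "e / 2" N] e(1) by simp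
qed

lemma padic_norm_inverse:
  assumes p: "prime p"
  shows "padic_norm p (inverse x) = inverse (padic_norm p x)"
proof (cases "x = 0")
  case False
  hence "padic_norm p x * padic_norm p (inverse x) = 1" by (simp flip: padic_norm_mult[OF p])
  thus ?thesis by (metis inverse_unique)
qed auto

lemma padic_Cauchy_inverse:
  assumes p: "prime p" and X: "padic_Cauchy p X" and nn: "X \<notin> padic_null_seqs p"
  shows "padic_Cauchy p (\<lambda>n. inverse (X n))"
  unfolding padic_Cauchy_def
proof (intro allI impI)
  fix e :: real assume e: "e > 0"
  obtain c M where c: "c > 0" and M: "\<And>n. n \<ge> M \<Longrightarrow> padic_norm p (X n) \<ge> c"
    using padic_Cauchy_nonnull_bounded_below[OF p X nn] by metis
  have "e * (c * c) > 0" using e c by simp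
  then obtain N where N: "\<And>m n. m \<ge> N \<Longrightarrow> n \<ge> N \<Longrightarrow> padic_norm p (X m - X n) < e * (c * c)"
    using X unfolding padic_Cauchy_def by meson
  have "padic_norm p (inverse (X m) - inverse (X n)) < e" if mn: "m \<ge> max M N" "n \<ge> max M N" for m n
  proof -
    have pos: "padic_norm p (X m) \<ge> c" "padic_norm p (X n) \<ge> c" using M mn by auto
    hence nz: "X m \<noteq> 0" "X n \<noteq> 0" using c by auto
    have "inverse (X m) - inverse (X n) = (X n - X m) * inverse (X m * X n)"
      using nz by (simp add: field_simps)
    hence "padic_norm p (inverse (X m) - inverse (X n))
        = padic_norm p (X n - X m) / (padic_norm p (X m) * padic_norm p (X n))"
      by (simp add: padic_norm_mult[OF p] padic_norm_inverse[OF p] divide_inverse del: inverse_mult_distrib)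
    also have "\<dots> \<le> padic_norm p (X n - X m) / (c * c)"
      using pos c by (intro divide_left_mono mult_mono mult_pos_pos) auto
    also have "\<dots> < e" using N[of n m] mn c by (simp add: pos_divide_less_eq)
    finally show ?thesis .
  qed
  thus "\<exists>N. \<forall>m\<ge>N. \<forall>n\<ge>N. padic_norm p (inverse (X m) - inverse (X n)) < e" by blast
qed

lemma field_padic_field:
  assumes p: "prime p"
  shows "field (padic_field p)"
proof -
  let ?R = "padic_Cauchy_ring p" and ?I = "padic_null_seqs p"
  interpret ideal ?I ?R by (rule ideal_padic_null_seqs[OF p])
  interpret C: cring ?R by (rule cring_padic_Cauchy_ring[OF p])
  interpret Q: cring "?R Quot ?I" by (rule quotient_is_cring[OF C.is_cring])
  have zero: "\<zero>\<^bsub>?R Quot ?I\<^esub> = ?I" by (simp add: FactRing_def)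
  have one: "\<one>\<^bsub>?R Quot ?I\<^esub> = ?I +>\<^bsub>?R\<^esub> \<one>\<^bsub>?R\<^esub>" by (simp add: FactRing_def)
  have one_notin: "\<one>\<^bsub>?R\<^esub> \<notin> ?I"
    by (auto simp: padic_Cauchy_ring_def padic_null_seqs_def LIMSEQ_const_iff)
  have "\<exists>b\<in>carrier (?R Quot ?I). a \<otimes>\<^bsub>?R Quot ?I\<^esub> b = \<one>\<^bsub>?R Quot ?I\<^esub>"
    if aQ: "a \<in> carrier (?R Quot ?I)" and a0: "a \<noteq> \<zero>\<^bsub>?R Quot ?I\<^esub>" for a
  proof -
    obtain X where X: "X \<in> carrier ?R" "a = ?I +>\<^bsub>?R\<^esub> X"
      using aQ by (auto simp: FactRing_def A_RCOSETS_def')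
    have XI: "X \<notin> ?I" using a0 X(2) by (auto simp: zero a_rcos_const)
    have XC: "padic_Cauchy p X" using X by (simp add: padic_Cauchy_ring_def)
    define Y where "Y = (\<lambda>n. inverse (X n))"
    have Y: "Y \<in> carrier ?R"
      using padic_Cauchy_inverse[OF p XC XI] by (simp add: Y_def padic_Cauchy_ring_def)
    obtain c N where c: "c > 0" "\<And>n. n \<ge> N \<Longrightarrow> padic_norm p (X n) \<ge> c"
      using padic_Cauchy_nonnull_bounded_below[OF p XC XI] by metis
    have "padic_norm p (X n * Y n - 1) = 0" if "n \<ge> N" for n
      using c(1) c(2)[OF that] by (cases "X n = 0") (auto simp: Y_def)
    hence "(\<lambda>n. padic_norm p (X n * Y n - 1)) \<longlonglongrightarrow> 0"
      by (intro tendsto_eventually) (auto simp: eventually_sequentially)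
    hence nul: "(\<lambda>n. X n * Y n - 1) \<in> ?I" by (simp add: padic_null_seqs_def)
    have "X \<otimes>\<^bsub>?R\<^esub> Y = (\<lambda>n. X n * Y n - 1) \<oplus>\<^bsub>?R\<^esub> \<one>\<^bsub>?R\<^esub>"
      by (simp add: padic_Cauchy_ring_def)
    hence "X \<otimes>\<^bsub>?R\<^esub> Y \<in> ?I +>\<^bsub>?R\<^esub> \<one>\<^bsub>?R\<^esub>"
      using nul by (auto simp: a_r_coset_def')
    hence "?I +>\<^bsub>?R\<^esub> (X \<otimes>\<^bsub>?R\<^esub> Y) = ?I +>\<^bsub>?R\<^esub> \<one>\<^bsub>?R\<^esub>"
      using a_repr_independence[OF _ one_closed a_subgroup] by simp
    moreover have "a \<otimes>\<^bsub>?R Quot ?I\<^esub> (?I +>\<^bsub>?R\<^esub> Y) = ?I +>\<^bsub>?R\<^esub> (X \<otimes>\<^bsub>?R\<^esub> Y)"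
      using X Y by (simp add: FactRing_def rcoset_mult_add)
    moreover have "?I +>\<^bsub>?R\<^esub> Y \<in> carrier (?R Quot ?I)"
      using Y by (auto simp: FactRing_def A_RCOSETS_def')
    ultimately show ?thesis by (auto simp: one)
  qed
  moreover have "\<zero>\<^bsub>?R Quot ?I\<^esub> \<noteq> \<one>\<^bsub>?R Quot ?I\<^esub>"
    using one_notin a_rcos_self[OF one_closed] by (auto simp: zero one)
  ultimately show ?thesis
    unfolding padic_field_def by (intro Q.cring_fieldI2) auto
qed

end

theory Submission
  imports Defs "Jordan_Normal_Form.Determinant"
begin

text \<open>The matrix \<open>N = M\<^sub>1 M\<^sub>2\<^sup>T + I\<close> satisfies \<open>N N\<^sup>T = \<sigma> I + \<tau> J\<close> and has constant row sums, so
  \<open>N\<^sup>T\<close> induces a similitude of factor \<open>\<sigma>\<close> on the hyperplane orthogonal to the all-ones vector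
  (which has norm \<open>v\<close>). Suppose \<open>\<sigma>\<close> is not a rational square. Splitting off planes \<open>\<langle>x, N x\<rangle>\<close>,
  each of discriminant minus a norm from \<open>\<rat>(\<surd>\<sigma>)\<close>, and restoring a similitude on the orthogonal
  complement by a reflection (Witt cancellation made explicit), one gets an orthogonal basis of
  \<open>\<rat>\<^sup>v\<close>. Hence \<open>v\<close> is odd, and since the discriminant of the standard form is a square,
  \<open>(-1)\<^bsup>(v-1)/2\<^esup> v\<close> is a norm from \<open>\<rat>(\<surd>\<sigma>)\<close>, so all the symbols \<open>(\<sigma>, (-1)\<^bsup>(v-1)/2\<^esup> v)\<^sub>p\<close> are 1.
  The remaining identity only needs that the norms form a group.\<close>

section \<open>The standard form on rational vectors: orthogonal systems and reflections\<close>

text \<open>Vectors are total functions of which only the values below \<open>v\<close> count.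
  Equality of vectors is therefore often expressed through their products with every
  \<open>z\<close>, and vanishing through \<open>dot v x x = 0\<close>.\<close>

definition dot :: "nat \<Rightarrow> (nat \<Rightarrow> rat) \<Rightarrow> (nat \<Rightarrow> rat) \<Rightarrow> rat" where
  "dot v x y = (\<Sum>i<v. x i * y i)"

lemma dot_commute: "dot v x y = dot v y x"
  by (simp add: dot_def mult.commute)

lemma dot_diff_left: "dot v (\<lambda>i. x i - y i) z = dot v x z - dot v y z"
  and dot_add_left: "dot v (\<lambda>i. x i + y i) z = dot v x z + dot v y z"
  and dot_scale_left: "dot v (\<lambda>i. c * x i) z = c * dot v x z"
  by (simp_all add: dot_def algebra_simps sum.distrib sum_subtractf sum_distrib_left)

lemma dot_diff_right: "dot v z (\<lambda>i. x i - y i) = dot v z x - dot v z y"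
  and dot_add_right: "dot v z (\<lambda>i. x i + y i) = dot v z x + dot v z y"
  and dot_scale_right: "dot v z (\<lambda>i. c * x i) = c * dot v z x"
  by (simp_all add: dot_def algebra_simps sum.distrib sum_subtractf sum_distrib_left)

lemmas dot_linear = dot_diff_left dot_add_left dot_scale_left
  dot_diff_right dot_add_right dot_scale_right

lemma dot_self_eq_0_iff: "dot v x x = 0 \<longleftrightarrow> (\<forall>i<v. x i = 0)"
  by (simp add: dot_def sum_nonneg_eq_0_iff Ball_def)

lemma dot_null: "dot v x x = 0 \<Longrightarrow> dot v x y = 0"
  by (simp add: dot_self_eq_0_iff) (simp add: dot_def)

text \<open>Fewer than \<open>v\<close> linear conditions have a nonzero common solution, and over
  the rationals a nonzero vector has nonzero norm.\<close>

lemma exists_orthogonal_vector: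
  assumes "k < v"
  obtains x where "dot v x x \<noteq> 0" "\<And>i. i < k \<Longrightarrow> dot v (e i) x = 0"
proof -
  \<comment> \<open>The zero row in position \<open>k\<close> makes the square matrix singular; the
    rows after it only add further conditions on the solution.\<close>
  define B where "B = mat\<^sub>r v v (\<lambda>i. if i = k then 0\<^sub>v v else vec v (e i))"
  have B: "B \<in> carrier_mat v v" by (simp add: B_def)
  have "det B = 0" unfolding B_def by (rule det_row_0[OF assms]) auto
  then obtain w where w: "w \<in> carrier_vec v" "w \<noteq> 0\<^sub>v v" "B *\<^sub>v w = 0\<^sub>v v"
    using det_0_iff_vec_prod_zero_field[OF B] by auto
  have "dot v (e i) (\<lambda>j. w $ j) = 0" if "i < k" for i
  proof -
    have "(B *\<^sub>v w) $ i = 0" using w that assms by simp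
    thus ?thesis using that assms w
      by (simp add: B_def scalar_prod_def dot_def atLeast0LessThan)
  qed
  moreover have "dot v (\<lambda>j. w $ j) (\<lambda>j. w $ j) \<noteq> 0"
    using w by (auto simp: dot_self_eq_0_iff)
  ultimately show thesis using that by blast
qed

definition orthogonal_system :: "nat \<Rightarrow> nat \<Rightarrow> (nat \<Rightarrow> nat \<Rightarrow> rat) \<Rightarrow> bool" where
  "orthogonal_system v k e \<longleftrightarrow>
     (\<forall>i<k. dot v (e i) (e i) \<noteq> 0) \<and> (\<forall>i<k. \<forall>j<k. i \<noteq> j \<longrightarrow> dot v (e i) (e j) = 0)"

text \<open>The Gram matrix of an orthogonal basis is diagonal, and it is also the basis matrix
  times its transpose. So the product of the norms is a rational square.\<close>

lemma orthogonal_system_det: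
  assumes "orthogonal_system v v e"
  shows "det (mat v v (\<lambda>(i, j). e i j)) ^ 2 = (\<Prod>i<v. dot v (e i) (e i))"
proof -
  define B where "B = mat v v (\<lambda>(i, j). e i j)"
  have B: "B \<in> carrier_mat v v" by (simp add: B_def)
  have ent: "(B * transpose_mat B) $$ (i, j) = (if i = j then dot v (e i) (e i) else 0)"
    if "i < v" "j < v" for i j
    using that assms
    by (auto simp: B_def scalar_prod_def dot_def atLeast0LessThan orthogonal_system_def)
  have "det B ^ 2 = det (B * transpose_mat B)"
    using B by (simp add: det_mult[of _ v] det_transpose power2_eq_square)
  also have "\<dots> = prod_list (diag_mat (B * transpose_mat B))"
    using B ent by (intro det_upper_triangular[of _ v]) (auto intro!: upper_triangularI)
  also have "\<dots> = (\<Prod>i<v. (B * transpose_mat B) $$ (i, i))"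
    using B by (simp add: prod_list_diag_prod atLeast0LessThan)
  also have "\<dots> = (\<Prod>i<v. dot v (e i) (e i))"
    using ent by (intro prod.cong) auto
  finally show ?thesis by (simp add: B_def)
qed

text \<open>By the determinant formula such a system is a basis. This is what excludes
  \<open>v + 1\<close> pairwise orthogonal vectors of nonzero norm.\<close>

lemma orthogonal_system_complete:
  assumes "orthogonal_system v v e" "\<And>i. i < v \<Longrightarrow> dot v (e i) x = 0"
  shows "dot v x x = 0"
proof -
  define B where "B = mat v v (\<lambda>(i, j). e i j)"
  have B: "B \<in> carrier_mat v v" by (simp add: B_def)
  have "(\<Prod>i<v. dot v (e i) (e i)) \<noteq> 0"
    using assms(1) by (simp add: orthogonal_system_def)
  hence "det B \<noteq> 0"
    using orthogonal_system_det[OF assms(1)] by (auto simp: B_def)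
  moreover have "B *\<^sub>v vec v x = 0\<^sub>v v"
    using assms(2) by (auto simp: B_def scalar_prod_def dot_def atLeast0LessThan)
  ultimately have "vec v x = 0\<^sub>v v"
    using det_0_iff_vec_prod_zero_field[OF B] vec_carrier[of v x] by blast
  hence "\<forall>i<v. x i = 0" by (metis index_vec index_zero_vec(1))
  thus ?thesis by (simp add: dot_self_eq_0_iff)
qed

text \<open>The identity if \<open>dot v u u = 0\<close>, because \<open>x / 0 = 0\<close>.\<close>

definition reflect :: "nat \<Rightarrow> (nat \<Rightarrow> rat) \<Rightarrow> (nat \<Rightarrow> rat) \<Rightarrow> nat \<Rightarrow> rat" where
  "reflect v u w = (\<lambda>i. w i - 2 * (dot v w u / dot v u u) * u i)"

lemma dot_reflect: "dot v (reflect v u w) z = dot v w z - 2 * (dot v w u / dot v u u) * dot v u z"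
  by (simp only: reflect_def dot_linear)

lemma dot_reflect_reflect: "dot v (reflect v u w) (reflect v u z) = dot v w z"
proof (cases "dot v u u = 0")
  case True
  thus ?thesis by (simp add: reflect_def)
next
  case False
  define c d where "c = dot v w u / dot v u u" and "d = dot v z u / dot v u u"
  have "dot v w u = c * dot v u u" "dot v z u = d * dot v u u"
    using False by (simp_all add: c_def d_def)
  thus ?thesis
    unfolding reflect_def c_def[symmetric] d_def[symmetric] dot_linear
    by (simp add: dot_commute[of v u w] dot_commute[of v u z] algebra_simps)
qed

text \<open>Reflecting in the difference of two vectors of equal norm carries one to the other. If
  the difference has norm 0, both vectors already have the same products, and the reflection is the
  identity.\<close>

lemma dot_reflect_diff:
  assumes "dot v x x = dot v y y"
  shows "dot v (reflect v (\<lambda>i. x i - y i) x) z = dot v y z"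
proof -
  define u where "u = (\<lambda>i. x i - y i)"
  have xu: "dot v x u = dot v u u / 2"
    using assms by (simp add: u_def dot_linear dot_commute[of v y x])
  have uz: "dot v u z = dot v x z - dot v y z" by (simp add: u_def dot_linear)
  show ?thesis
    unfolding u_def[symmetric] dot_reflect xu
    using uz dot_null[of v u z] by (cases "dot v u u = 0") simp_all
qed

section \<open>Similitudes: splitting off planes\<close>

text \<open>This is the invariant of the induction: \<open>N\<close> is any function that scales the
  form by \<open>\<sigma>\<close> on the complement of the first \<open>k\<close> vectors and maps
  this complement into itself.\<close>

definition similitude_on_perp ::
  "nat \<Rightarrow> rat \<Rightarrow> nat \<Rightarrow> (nat \<Rightarrow> nat \<Rightarrow> rat) \<Rightarrow> ((nat \<Rightarrow> rat) \<Rightarrow> nat \<Rightarrow> rat) \<Rightarrow> bool" where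
  "similitude_on_perp v \<sigma> k e N \<longleftrightarrow>
     (\<forall>x y. (\<forall>i<k. dot v (e i) x = 0) \<longrightarrow> (\<forall>i<k. dot v (e i) y = 0) \<longrightarrow>
        dot v (N x) (N y) = \<sigma> * dot v x y) \<and>
     (\<forall>x. (\<forall>i<k. dot v (e i) x = 0) \<longrightarrow> (\<forall>i<k. dot v (e i) (N x) = 0))"

text \<open>The plane spanned by \<open>x\<close> and \<open>y = N x\<close> has Gram determinant
  \<open>\<sigma> * a ^ 2 - b ^ 2\<close>, where \<open>a\<close> is the norm of \<open>x\<close>
  and \<open>b\<close> the product of \<open>x\<close> and \<open>y\<close>. (In the conclusion the
  two letters are exchanged.) Replacing \<open>N\<close> by a corrected \<open>N'\<close> allows the
  step to be repeated on the complement.\<close>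

lemma similitude_step:
  assumes e: "orthogonal_system v k e" and N: "similitude_on_perp v \<sigma> k e N"
    and k: "k < v" and \<sigma>: "\<sigma> \<noteq> 0" "\<And>c. \<sigma> \<noteq> c ^ 2"
  obtains e' N' a b where "orthogonal_system v (k + 2) e'" "similitude_on_perp v \<sigma> (k + 2) e' N'"
    "(\<Prod>i<k+2. dot v (e' i) (e' i)) = (\<Prod>i<k. dot v (e i) (e i)) * (\<sigma> * b ^ 2 - a ^ 2)"
proof -
  obtain x where x: "dot v x x \<noteq> 0" "\<And>i. i < k \<Longrightarrow> dot v (e i) x = 0"
    using exists_orthogonal_vector[OF k] by blast
  define y where "y = N x"
  define a where "a = dot v x x"
  define b where "b = dot v x y"
  define c where "c = b / a"
  have a: "a \<noteq> 0" using x by (simp add: a_def)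
  have b: "b = c * a" using a by (simp add: c_def)
  have sim: "dot v (N z) (N w) = \<sigma> * dot v z w"
    if "\<forall>i<k. dot v (e i) z = 0" "\<forall>i<k. dot v (e i) w = 0" for z w
    using N that by (simp add: similitude_on_perp_def)
  have pres: "\<forall>i<k. dot v (e i) (N z) = 0" if "\<forall>i<k. dot v (e i) z = 0" for z
    using N that by (simp add: similitude_on_perp_def)
  have xe: "\<forall>i<k. dot v (e i) x = 0" using x by simp
  have ye: "\<forall>i<k. dot v (e i) y = 0" using pres[OF xe] by (simp add: y_def)
  have Nye: "\<forall>i<k. dot v (e i) (N y) = 0" using pres[OF ye] .
  have yy: "dot v y y = \<sigma> * a" using sim[OF xe xe] by (simp add: y_def a_def)
  have NyNy: "dot v (N y) (N y) = \<sigma> ^ 2 * a"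
    using sim[OF ye ye] by (simp add: yy power2_eq_square)
  have yNy: "dot v y (N y) = \<sigma> * b" using sim[OF xe ye] by (simp add: y_def b_def)
  \<comment> \<open>Gram-Schmidt: \<open>c * x\<close> is the projection of \<open>y\<close> on
    \<open>x\<close>. The norm of \<open>y'\<close> is \<open>(\<sigma> - c ^ 2) * a\<close>,
    nonzero because \<open>\<sigma>\<close> is not a square.\<close>
  define y' where "y' = (\<lambda>i. y i - c * x i)"
  have yx: "dot v y x = b" by (simp add: b_def dot_commute)
  have y'y': "dot v y' y' = (\<sigma> - c ^ 2) * a"
    by (simp add: y'_def dot_linear yy yx b flip: a_def b_def) (simp add: algebra_simps power2_eq_square)
  have y'x: "dot v y' x = 0" "dot v x y' = 0"
    by (simp_all add: y'_def dot_linear yy yx b flip: a_def b_def)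
  have y'0: "dot v y' y' \<noteq> 0"
    using a \<sigma>(2)[of c] by (simp add: y'y')
  have y'e: "\<forall>i<k. dot v (e i) y' = 0" using xe ye by (simp add: y'_def dot_linear)
  define e' where "e' = e(k := x, Suc k := y')"
  have e'_old: "e' i = e i" if "i < k" for i using that by (simp add: e'_def)
  have e'_new: "e' k = x" "e' (Suc k) = y'" by (simp_all add: e'_def)
  have all: "(\<forall>i<k+2. dot v (e' i) z = 0) \<longleftrightarrow>
      (\<forall>i<k. dot v (e i) z = 0) \<and> dot v x z = 0 \<and> dot v y' z = 0" for z
    by (auto simp: less_Suc_eq e'_old e'_new)
  have "dot v x (e i) = 0" "dot v y' (e i) = 0" if "i < k" for i
    using that xe y'e by (metis dot_commute)+
  hence orth: "orthogonal_system v (k + 2) e'"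
    using e x(1) y'0 xe y'e y'x
    unfolding orthogonal_system_def by (auto simp: less_Suc_eq e'_old e'_new)
  have prod: "(\<Prod>i<k+2. dot v (e' i) (e' i)) = (\<Prod>i<k. dot v (e i) (e i)) * (\<sigma> * a ^ 2 - b ^ 2)"
    by (simp add: e'_new e'_old y'y' b flip: a_def) (simp add: algebra_simps power2_eq_square)
  txt \<open>\<open>T y\<close> is chosen so that \<open>x \<mapsto> y \<mapsto> T y\<close> is a similitude of the plane spanned by \<open>x, y\<close>;
    a reflection fixing \<open>y\<close> and moving \<open>N y\<close> to \<open>T y\<close> makes \<open>N\<close> preserve that plane, and hence
    its complement.\<close>
  define Ty where "Ty = (\<lambda>i. (2 * c) * y i - \<sigma> * x i)"
  define u where "u = (\<lambda>i. N y i - Ty i)"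
  define N' where "N' = (\<lambda>z. reflect v u (N z))"
  have TyTy: "dot v Ty Ty = \<sigma> ^ 2 * a"
    by (simp add: Ty_def dot_linear yy yx b flip: a_def b_def) (simp add: algebra_simps power2_eq_square)
  have yTy: "dot v y Ty = \<sigma> * b"
    by (simp add: Ty_def dot_linear yy yx b)
  have yu: "dot v y u = 0" using yTy yNy by (simp add: u_def dot_linear)
  have N'y: "dot v (N' y) z = dot v Ty z" for z
    unfolding N'_def u_def by (rule dot_reflect_diff) (simp add: TyTy NyNy)
  have N'x: "N' x = y" using yu by (simp add: N'_def reflect_def flip: y_def)
  have N'N': "dot v (N' z) (N' w) = dot v (N z) (N w)" for z w
    by (simp add: N'_def dot_reflect_reflect)
  have ue: "\<forall>i<k. dot v (e i) u = 0" using Nye xe ye by (simp add: u_def Ty_def dot_linear)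
  have sim': "dot v (N' z) (N' w) = \<sigma> * dot v z w"
    if "\<forall>i<k. dot v (e i) z = 0" "\<forall>i<k. dot v (e i) w = 0" for z w
    using sim[OF that] by (simp only: N'N')
  have pres': "(\<forall>i<k. dot v (e i) (N' z) = 0) \<and> dot v x (N' z) = 0 \<and> dot v y' (N' z) = 0"
    if z: "\<forall>i<k. dot v (e i) z = 0" "dot v x z = 0" "dot v y' z = 0" for z
  proof -
    have yz: "dot v y z = 0" using z(2,3) unfolding y'_def dot_linear by simp
    \<comment> \<open>\<open>N'\<close> sends \<open>x\<close> to \<open>y\<close> and, as far as
      products can tell, \<open>y\<close> to \<open>Ty\<close>. So \<open>N' z\<close> is orthogonal
      to \<open>y\<close> and \<open>Ty\<close>, whose span contains \<open>x\<close> because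
      \<open>\<sigma> \<noteq> 0\<close>.\<close>
    have *: "dot v y (N' z) = 0" using sim'[OF xe z(1)] z(2) unfolding N'x by simp
    have "dot v Ty (N' z) = 0" using sim'[OF ye z(1)] yz unfolding N'y by simp
    hence **: "dot v x (N' z) = 0" using * \<sigma>(1) unfolding Ty_def dot_linear by simp
    have "dot v y' (N' z) = 0" using * ** unfolding y'_def dot_linear by simp
    moreover have "\<forall>i<k. dot v (e i) (N' z) = 0"
      using pres[OF z(1)] ue unfolding N'_def reflect_def dot_linear by simp
    ultimately show ?thesis using ** by blast
  qed
  have "similitude_on_perp v \<sigma> (k + 2) e' N'"
    unfolding similitude_on_perp_def all using sim' pres' by blast
  with orth prod show thesis using that by blast
qed

text \<open>Each plane contributes minus a norm \<open>a ^ 2 - \<sigma> * b ^ 2\<close>; the sign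
  \<open>(-1) ^ j\<close> removes the minus signs, and norms multiply to a norm. For
  \<open>v = 2 * j\<close> the bound on \<open>j\<close> still admits a system of
  \<open>v + 1\<close> vectors, which yields the contradiction for even \<open>v\<close>.\<close>

lemma similitude_chain:
  assumes e: "orthogonal_system v 1 e" and N: "similitude_on_perp v \<sigma> 1 e N"
    and \<sigma>: "\<sigma> \<noteq> 0" "\<And>c. \<sigma> \<noteq> c ^ 2" and j: "2 * j \<le> v"
  shows "\<exists>e' X Y. orthogonal_system v (2 * j + 1) e' \<and>
    (-1) ^ j * (\<Prod>i<2*j+1. dot v (e' i) (e' i)) = dot v (e 0) (e 0) * (X ^ 2 - \<sigma> * Y ^ 2)"
proof -
  have "\<exists>e' N' X Y. orthogonal_system v (2 * j + 1) e' \<and> similitude_on_perp v \<sigma> (2 * j + 1) e' N' \<and>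
    (-1) ^ j * (\<Prod>i<2*j+1. dot v (e' i) (e' i)) = dot v (e 0) (e 0) * (X ^ 2 - \<sigma> * Y ^ 2)"
    using j
  proof (induction j)
    case 0
    show ?case by (rule exI[of _ e], rule exI[of _ N], rule exI[of _ 1], rule exI[of _ 0]) (use e N in simp)
  next
    case (Suc j)
    then obtain e' N' X Y where IH: "orthogonal_system v (2 * j + 1) e'"
      "similitude_on_perp v \<sigma> (2 * j + 1) e' N'"
      "(-1) ^ j * (\<Prod>i<2*j+1. dot v (e' i) (e' i)) = dot v (e 0) (e 0) * (X ^ 2 - \<sigma> * Y ^ 2)"
      by auto
    have k: "2 * j + 1 < v" using Suc.prems by simp
    obtain e'' N'' a b where s: "orthogonal_system v (2 * j + 1 + 2) e''"
      "similitude_on_perp v \<sigma> (2 * j + 1 + 2) e'' N''"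
      "(\<Prod>i<2*j+1+2. dot v (e'' i) (e'' i)) = (\<Prod>i<2*j+1. dot v (e' i) (e' i)) * (\<sigma> * b ^ 2 - a ^ 2)"
      by (rule similitude_step[OF IH(1,2) k \<sigma>])
    have "(-1) ^ Suc j * (\<Prod>i<2*j+1+2. dot v (e'' i) (e'' i))
        = ((-1) ^ j * (\<Prod>i<2*j+1. dot v (e' i) (e' i))) * (a ^ 2 - \<sigma> * b ^ 2)"
      unfolding s(3) by (simp add: algebra_simps)
    \<comment> \<open>The product of \<open>X + Y * sqrt \<sigma>\<close> and
      \<open>a + b * sqrt \<sigma>\<close>, written out in norms.\<close>
    also have "\<dots> = dot v (e 0) (e 0) * ((X * a + \<sigma> * Y * b) ^ 2 - \<sigma> * (X * b + Y * a) ^ 2)"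
      unfolding IH(3) by (simp add: algebra_simps power2_eq_square)
    finally have "(-1) ^ Suc j * (\<Prod>i<2*j+1+2. dot v (e'' i) (e'' i))
        = dot v (e 0) (e 0) * ((X * a + \<sigma> * Y * b) ^ 2 - \<sigma> * (X * b + Y * a) ^ 2)" .
    moreover have "2 * Suc j + 1 = 2 * j + 1 + 2" by simp
    ultimately show ?case using s(1,2) by (intro exI conjI) (simp_all only:)
  qed
  thus ?thesis by blast
qed

text \<open>For odd \<open>v\<close> the planes together with \<open>e 0\<close> fill the whole
  space, where the product of the norms is a nonzero square \<open>s ^ 2\<close>. Multiplying the
  relation of the chain by the norm of \<open>e 0\<close> gives the solution, with
  \<open>y = s\<close>.\<close>

lemma similitude_norm:
  assumes e: "orthogonal_system v 1 e" and N: "similitude_on_perp v \<sigma> 1 e N"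
    and \<sigma>: "\<sigma> \<noteq> 0" "\<And>c. \<sigma> \<noteq> c ^ 2"
  shows "odd v \<and> (\<exists>x y z. y \<noteq> 0 \<and> \<sigma> * x ^ 2 + (-1) ^ ((v - 1) div 2) * dot v (e 0) (e 0) * y ^ 2 = z ^ 2)"
proof -
  have odd: "odd v"
  proof
    assume "even v"
    then obtain j where j: "v = 2 * j" by blast
    obtain e' where e': "orthogonal_system v (v + 1) e'"
      using similitude_chain[OF e N \<sigma>, of j] j by auto
    have "orthogonal_system v v e'" using e' by (auto simp: orthogonal_system_def)
    hence "dot v (e' v) (e' v) = 0"
      by (rule orthogonal_system_complete) (use e' in \<open>auto simp: orthogonal_system_def\<close>)
    thus False using e' by (auto simp: orthogonal_system_def)
  qed
  define j where "j = (v - 1) div 2"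
  have v: "v = 2 * j + 1" using odd by (auto simp: j_def elim: oddE)
  obtain e' X Y where e': "orthogonal_system v v e'"
    "(-1) ^ j * (\<Prod>i<v. dot v (e' i) (e' i)) = dot v (e 0) (e 0) * (X ^ 2 - \<sigma> * Y ^ 2)"
    using similitude_chain[OF e N \<sigma>, of j] v by auto
  define s where "s = det (mat v v (\<lambda>(i, j). e' i j))"
  have s: "s ^ 2 = (\<Prod>i<v. dot v (e' i) (e' i))"
    unfolding s_def by (rule orthogonal_system_det[OF e'(1)])
  have "s ^ 2 \<noteq> 0" unfolding s using e'(1) by (simp add: orthogonal_system_def)
  hence s0: "s \<noteq> 0" by simp
  let ?d = "dot v (e 0) (e 0)"
  have "\<sigma> * (?d * Y) ^ 2 + (-1) ^ j * ?d * s ^ 2 = ?d * (?d * \<sigma> * Y ^ 2 + (-1) ^ j * s ^ 2)"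
    by (simp add: algebra_simps power2_eq_square)
  also have "\<dots> = (?d * X) ^ 2"
    unfolding s e'(2) by (simp add: algebra_simps power2_eq_square)
  finally show ?thesis using odd s0 unfolding j_def by blast
qed

section \<open>The Hilbert symbol through Cauchy sequences, and the group of norms\<close>

lemma hilbert_symbol_values: "hilbert_symbol p a b = 1 \<or> hilbert_symbol p a b = - 1"
  by (simp add: hilbert_symbol_def Let_def)

text \<open>The p-adic field has no zero divisors, stated for representatives: non-null Cauchy
  sequences eventually stay away from 0, hence so does their product.\<close>

lemma padic_null_mult_iff:
  assumes p: "prime p" and X: "padic_Cauchy p X" and Y: "padic_Cauchy p Y"
  shows "(\<lambda>n. X n * Y n) \<in> padic_null_seqs p \<longleftrightarrow> X \<in> padic_null_seqs p \<or> Y \<in> padic_null_seqs p"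
proof
  assume XY: "(\<lambda>n. X n * Y n) \<in> padic_null_seqs p"
  show "X \<in> padic_null_seqs p \<or> Y \<in> padic_null_seqs p"
  proof (rule ccontr)
    assume "\<not> (X \<in> padic_null_seqs p \<or> Y \<in> padic_null_seqs p)"
    then obtain c d M N where c: "c > 0" "\<And>n. n \<ge> M \<Longrightarrow> padic_norm p (X n) \<ge> c"
      and d: "d > 0" "\<And>n. n \<ge> N \<Longrightarrow> padic_norm p (Y n) \<ge> d"
      using padic_Cauchy_nonnull_bounded_below[OF p X] padic_Cauchy_nonnull_bounded_below[OF p Y]
      by metis
    have "(\<lambda>n. padic_norm p (X n * Y n)) \<longlonglongrightarrow> 0" using XY by (simp add: padic_null_seqs_def)
    moreover have "\<forall>\<^sub>F n in sequentially. c * d \<le> padic_norm p (X n * Y n)"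
      using eventually_ge_at_top[of "max M N"]
    proof eventually_elim
      case (elim n)
      thus ?case using c d by (simp add: padic_norm_mult[OF p] mult_mono)
    qed
    ultimately have "c * d \<le> 0" by (intro tendsto_lowerbound) auto
    thus False using c(1) d(1) by (simp add: mult_le_0_iff)
  qed
next
  assume "X \<in> padic_null_seqs p \<or> Y \<in> padic_null_seqs p"
  thus "(\<lambda>n. X n * Y n) \<in> padic_null_seqs p"
    using padic_null_mult[OF p X, of Y] padic_null_mult[OF p Y, of X] by (auto simp: mult.commute)
qed

lemma padic_null_diff:
  assumes p: "prime p" and "X \<in> padic_null_seqs p" "Y \<in> padic_null_seqs p"
  shows "(\<lambda>n. X n - Y n) \<in> padic_null_seqs p"
  using padic_null_add[OF p assms(2) padic_null_mult[OF p padic_Cauchy_const[of p "-1"] assms(3)]]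
  by simp

text \<open>Removes the quotient ring: classes become Cauchy sequences, and equations hold up to
  null sequences. The later arguments about the symbol rest on this form.\<close>

lemma hilbert_symbol_eq_1_iff:
  assumes p: "prime p"
  shows "hilbert_symbol p a b = 1 \<longleftrightarrow>
    (\<exists>X Y Z. padic_Cauchy p X \<and> padic_Cauchy p Y \<and> padic_Cauchy p Z \<and>
       \<not> (X \<in> padic_null_seqs p \<and> Y \<in> padic_null_seqs p \<and> Z \<in> padic_null_seqs p) \<and>
       (\<lambda>n. a * X n ^ 2 + b * Y n ^ 2 - Z n ^ 2) \<in> padic_null_seqs p)"
proof -
  let ?R = "padic_Cauchy_ring p" and ?I = "padic_null_seqs p" and ?K = "padic_field p"
  interpret ideal ?I ?R by (rule ideal_padic_null_seqs[OF p])
  interpret Q: field ?K by (rule field_padic_field[OF p])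
  \<comment> \<open>The quotient map from Cauchy sequences to the p-adic field.\<close>
  define h where "h X = ?I +>\<^bsub>?R\<^esub> X" for X
  have h_eq: "h X = h Y \<longleftrightarrow> (\<lambda>n. X n - Y n) \<in> ?I" if "padic_Cauchy p X" "padic_Cauchy p Y" for X Y
  proof -
    have XY: "X \<in> carrier ?R" "Y \<in> carrier ?R" using that by (simp_all add: padic_Cauchy_ring_def)
    have "\<ominus>\<^bsub>?R\<^esub> Y = (\<lambda>n. - Y n)"
      using that by (intro minus_equality) (auto simp: padic_Cauchy_ring_def padic_Cauchy_uminus[OF p])
    hence "X \<ominus>\<^bsub>?R\<^esub> Y = (\<lambda>n. X n - Y n)"
      by (simp add: a_minus_def) (simp add: padic_Cauchy_ring_def)
    thus ?thesis unfolding h_def using a_rcos_module_minus[OF ring_axioms XY(2,1)] a_rcos_self[OF XY(1)]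
      a_repr_independence'[OF _ XY(2), of X] by metis
  qed
  have carrier: "carrier ?K = h ` {X. padic_Cauchy p X}"
    by (auto simp: padic_field_def FactRing_def A_RCOSETS_def' padic_Cauchy_ring_def h_def)
  have zero: "\<zero>\<^bsub>?K\<^esub> = h (\<lambda>_. 0)"
    using a_rcos_const[OF additive_subgroup.zero_closed[OF is_additive_subgroup]] by (simp add: padic_field_def FactRing_def h_def padic_Cauchy_ring_def)
  have mult: "h X \<otimes>\<^bsub>?K\<^esub> h Y = h (\<lambda>n. X n * Y n)" if "padic_Cauchy p X" "padic_Cauchy p Y" for X Y
    using rcoset_mult_add[of X Y] that
    by (simp add: padic_field_def FactRing_def h_def) (simp add: padic_Cauchy_ring_def)
  have add: "h X \<oplus>\<^bsub>?K\<^esub> h Y = h (\<lambda>n. X n + Y n)" if "padic_Cauchy p X" "padic_Cauchy p Y" for X Y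
    using a_rcos_sum[of X Y] that
    by (simp add: padic_field_def FactRing_def h_def) (simp add: padic_Cauchy_ring_def)
  have sq: "h X [^]\<^bsub>?K\<^esub> (2::nat) = h (\<lambda>n. X n ^ 2)" if "padic_Cauchy p X" for X
    using that carrier by (simp add: numeral_2_eq_2 Q.nat_pow_Suc mult power2_eq_square)
  have Csq: "padic_Cauchy p (\<lambda>n. X n ^ 2)" if "padic_Cauchy p X" for X
    using padic_Cauchy_mult[OF p that that] by (simp add: power2_eq_square)
  have null: "h X = \<zero>\<^bsub>?K\<^esub> \<longleftrightarrow> X \<in> ?I" if "padic_Cauchy p X" for X
    using h_eq[OF that, of "\<lambda>_. 0"] by (simp add: zero)
  have eqn: "padic_of_rat p a \<otimes>\<^bsub>?K\<^esub> h X [^]\<^bsub>?K\<^esub> (2::nat) \<oplus>\<^bsub>?K\<^esub> padic_of_rat p b \<otimes>\<^bsub>?K\<^esub> h Y [^]\<^bsub>?K\<^esub> (2::nat)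
      = h Z [^]\<^bsub>?K\<^esub> (2::nat) \<longleftrightarrow> (\<lambda>n. a * X n ^ 2 + b * Y n ^ 2 - Z n ^ 2) \<in> ?I"
    if "padic_Cauchy p X" "padic_Cauchy p Y" "padic_Cauchy p Z" for X Y Z
    using that by (simp add: padic_of_rat_def sq mult add h_eq Csq padic_Cauchy_mult[OF p] padic_Cauchy_add[OF p] flip: h_def)
  have "hilbert_symbol p a b = 1 \<longleftrightarrow> (\<exists>X Y Z. padic_Cauchy p X \<and> padic_Cauchy p Y \<and> padic_Cauchy p Z \<and>
      \<not> (h X = \<zero>\<^bsub>?K\<^esub> \<and> h Y = \<zero>\<^bsub>?K\<^esub> \<and> h Z = \<zero>\<^bsub>?K\<^esub>) \<and>
      padic_of_rat p a \<otimes>\<^bsub>?K\<^esub> h X [^]\<^bsub>?K\<^esub> (2::nat) \<oplus>\<^bsub>?K\<^esub> padic_of_rat p b \<otimes>\<^bsub>?K\<^esub> h Y [^]\<^bsub>?K\<^esub> (2::nat)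
        = h Z [^]\<^bsub>?K\<^esub> (2::nat))"
    unfolding hilbert_symbol_def Let_def carrier by simp
  also have "\<dots> \<longleftrightarrow> (\<exists>X Y Z. padic_Cauchy p X \<and> padic_Cauchy p Y \<and> padic_Cauchy p Z \<and>
      \<not> (X \<in> ?I \<and> Y \<in> ?I \<and> Z \<in> ?I) \<and>
      (\<lambda>n. a * X n ^ 2 + b * Y n ^ 2 - Z n ^ 2) \<in> ?I)"
    by (simp only: null eqn cong: conj_cong)
  finally show ?thesis .
qed

lemma hilbert_symbol_eq_1I:
  assumes p: "prime p" and nz: "\<not> (x = 0 \<and> y = 0 \<and> z = 0)" and eq: "a * x ^ 2 + b * y ^ 2 = z ^ 2"
  shows "hilbert_symbol p a b = 1"
  unfolding hilbert_symbol_eq_1_iff[OF p]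
  by (rule exI[of _ "\<lambda>_. x"], rule exI[of _ "\<lambda>_. y"], rule exI[of _ "\<lambda>_. z"])
    (use nz eq p in \<open>auto simp: padic_null_seqs_def LIMSEQ_const_iff padic_norm_eq_0_iff\<close>)

text \<open>Substitute \<open>c * Y\<close> for \<open>Y\<close>; the solution stays nontrivial
  because \<open>c\<close> is nonzero.\<close>

lemma hilbert_symbol_cancel_square:
  assumes p: "prime p" and c: "c \<noteq> 0" and h: "hilbert_symbol p a (c ^ 2 * b) = 1"
  shows "hilbert_symbol p a b = 1"
proof -
  obtain X Y Z where XYZ: "padic_Cauchy p X" "padic_Cauchy p Y" "padic_Cauchy p Z"
    and nz: "\<not> (X \<in> padic_null_seqs p \<and> Y \<in> padic_null_seqs p \<and> Z \<in> padic_null_seqs p)"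
    and eq: "(\<lambda>n. a * X n ^ 2 + (c ^ 2 * b) * Y n ^ 2 - Z n ^ 2) \<in> padic_null_seqs p"
    using h unfolding hilbert_symbol_eq_1_iff[OF p] by blast
  have "(\<lambda>_. c) \<notin> padic_null_seqs p"
    using c by (simp add: padic_null_seqs_def LIMSEQ_const_iff padic_norm_eq_0_iff[OF p])
  hence "\<not> (X \<in> padic_null_seqs p \<and> (\<lambda>n. c * Y n) \<in> padic_null_seqs p \<and> Z \<in> padic_null_seqs p)"
    using nz padic_null_mult_iff[OF p padic_Cauchy_const XYZ(2), of c] by blast
  moreover have "(\<lambda>n. a * X n ^ 2 + b * (c * Y n) ^ 2 - Z n ^ 2) \<in> padic_null_seqs p"
    using eq by (simp add: power_mult_distrib mult_ac)
  ultimately show ?thesis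
    unfolding hilbert_symbol_eq_1_iff[OF p]
    using XYZ padic_Cauchy_mult[OF p padic_Cauchy_const[of p c] XYZ(2)]
    by (intro exI[of _ X] exI[of _ "\<lambda>n. c * Y n"] exI[of _ Z]) simp
qed

text \<open>Brahmagupta's identity: the norms of \<open>K(\<surd>a)\<close> are closed under multiplication. If one of the norms has a null \<open>Y\<close>, then \<open>a\<close> is itself a square.\<close>

lemma hilbert_symbol_mult_eq_1:
  assumes p: "prime p" and hb: "hilbert_symbol p a b = 1" and hc: "hilbert_symbol p a c = 1"
  shows "hilbert_symbol p a (b * c) = 1"
proof -
  let ?I = "padic_null_seqs p"
  note Cauchy = padic_Cauchy_mult[OF p] padic_Cauchy_add[OF p] padic_Cauchy_const
  obtain X Y Z where XYZ: "padic_Cauchy p X" "padic_Cauchy p Y" "padic_Cauchy p Z"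
    and nz: "\<not> (X \<in> ?I \<and> Y \<in> ?I \<and> Z \<in> ?I)"
    and eq: "(\<lambda>n. a * X n ^ 2 + b * Y n ^ 2 - Z n ^ 2) \<in> ?I"
    using hb unfolding hilbert_symbol_eq_1_iff[OF p] by blast
  obtain X' Y' Z' where XYZ': "padic_Cauchy p X'" "padic_Cauchy p Y'" "padic_Cauchy p Z'"
    and nz': "\<not> (X' \<in> ?I \<and> Y' \<in> ?I \<and> Z' \<in> ?I)"
    and eq': "(\<lambda>n. a * X' n ^ 2 + c * Y' n ^ 2 - Z' n ^ 2) \<in> ?I"
    using hc unfolding hilbert_symbol_eq_1_iff[OF p] by blast
  \<comment> \<open>With \<open>V\<close> null the coefficient \<open>d\<close> drops out of the
    equation, so the second coordinate can be set to 0 and \<open>d\<close> replaced by any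
    \<open>d'\<close>.\<close>
  have square: "hilbert_symbol p a d' = 1"
    if U: "padic_Cauchy p U" "padic_Cauchy p V" "padic_Cauchy p W" "V \<in> ?I"
      "\<not> (U \<in> ?I \<and> V \<in> ?I \<and> W \<in> ?I)" "(\<lambda>n. a * U n ^ 2 + d * V n ^ 2 - W n ^ 2) \<in> ?I" for U V W d d'
  proof -
    have "(\<lambda>n. d * V n * V n) \<in> ?I"
      using U by (intro padic_null_mult[OF p]) (auto intro!: Cauchy)
    from padic_null_diff[OF p U(6) this] have "(\<lambda>n. a * U n ^ 2 + d' * 0 ^ 2 - W n ^ 2) \<in> ?I"
      by (simp add: power2_eq_square algebra_simps)
    thus ?thesis unfolding hilbert_symbol_eq_1_iff[OF p] using U
      by (intro exI[of _ U] exI[of _ "\<lambda>_. 0"] exI[of _ W]) simp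
  qed
  show ?thesis
  proof (cases "Y \<in> ?I \<or> Y' \<in> ?I")
    case True
    thus ?thesis using square[OF XYZ _ nz eq] square[OF XYZ' _ nz' eq'] by blast
  next
    case False
    define U where "U = (\<lambda>n. Z n * X' n + Z' n * X n)"
    define V where "V = (\<lambda>n. Y n * Y' n)"
    define W where "W = (\<lambda>n. Z n * Z' n + a * X n * X' n)"
    have C: "padic_Cauchy p U" "padic_Cauchy p V" "padic_Cauchy p W"
      unfolding U_def V_def W_def using XYZ XYZ' by (auto intro!: Cauchy)
    have V: "V \<notin> ?I" unfolding V_def using False padic_null_mult_iff[OF p XYZ(2) XYZ'(2)] by blast
    define E where "E = (\<lambda>n. a * X n ^ 2 + b * Y n ^ 2 - Z n ^ 2)"
    define E' where "E' = (\<lambda>n. a * X' n ^ 2 + c * Y' n ^ 2 - Z' n ^ 2)"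
    \<comment> \<open>\<open>E\<close> and \<open>E'\<close> are the errors of the two given
      equations. The multipliers are chosen so that the sum of the multiples is exactly the error of
      the product equation.\<close>
    have "(\<lambda>n. b * Y n * Y n * E' n) \<in> ?I"
      by (intro padic_null_mult[OF p]) (use eq' XYZ in \<open>auto simp: E'_def intro!: Cauchy\<close>)
    moreover have "(\<lambda>n. (Z' n * Z' n + (- a) * X' n * X' n) * E n) \<in> ?I"
      by (intro padic_null_mult[OF p]) (use eq XYZ' in \<open>auto simp: E_def intro!: Cauchy simp del: mult_minus_left\<close>)
    ultimately have "(\<lambda>n. b * Y n * Y n * E' n + (Z' n * Z' n + (- a) * X' n * X' n) * E n) \<in> ?I"
      by (rule padic_null_add[OF p])
    also have "(\<lambda>n. b * Y n * Y n * E' n + (Z' n * Z' n + (- a) * X' n * X' n) * E n)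
        = (\<lambda>n. a * U n ^ 2 + (b * c) * V n ^ 2 - W n ^ 2)"
      by (rule ext) (simp add: E_def E'_def U_def V_def W_def power2_eq_square algebra_simps)
    finally show ?thesis unfolding hilbert_symbol_eq_1_iff[OF p] using C V by blast
  qed
qed

lemma hilbert_symbol_minus_self: "prime p \<Longrightarrow> hilbert_symbol p a (- a) = 1"
  by (rule hilbert_symbol_eq_1I[of p 1 1 0]) auto

text \<open>The product of \<open>b\<close> and \<open>b * c\<close> is \<open>b ^ 2 * c\<close>,
  and the square cancels.\<close>

lemma hilbert_symbol_cancel:
  assumes p: "prime p" and b: "b \<noteq> 0" and hb: "hilbert_symbol p a b = 1" "hilbert_symbol p a (b * c) = 1"
  shows "hilbert_symbol p a c = 1"
  using hilbert_symbol_cancel_square[OF p b, of a c] hilbert_symbol_mult_eq_1[OF p hb]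
  by (simp add: power2_eq_square mult.assoc)

text \<open>The part of bimultiplicativity that follows from the norms forming a group: multiplying
  by a norm does not change the symbol.\<close>

lemma hilbert_symbol_mult_left_iff:
  assumes "prime p" "b \<noteq> 0" "hilbert_symbol p a b = 1"
  shows "hilbert_symbol p a (b * c) = hilbert_symbol p a c"
  using hilbert_symbol_cancel[OF assms] hilbert_symbol_mult_eq_1[OF assms(1,3)]
    hilbert_symbol_values[of p a "b * c"] hilbert_symbol_values[of p a c] by (metis one_neq_neg_one)

lemma hilbert_symbol_self:
  assumes "prime p" "a \<noteq> 0"
  shows "hilbert_symbol p a a = hilbert_symbol p a (- 1)"
  using hilbert_symbol_mult_left_iff[OF assms(1) _ hilbert_symbol_minus_self[OF assms(1)], of a "-1"]
    assms(2) by simp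

lemma hilbert_symbol_minus_one:
  assumes "prime p" "b \<noteq> 0" "hilbert_symbol p a (- b) = 1"
  shows "hilbert_symbol p a (- 1) = hilbert_symbol p a b"
  using hilbert_symbol_mult_left_iff[OF assms(1) _ assms(3), of "- 1"] assms(2) by simp

section \<open>From designs to a similitude\<close>

text \<open>Matrices are coefficient functions here, so transposing is exchanging the two
  arguments.\<close>

definition mat_app :: "nat \<Rightarrow> (nat \<Rightarrow> nat \<Rightarrow> rat) \<Rightarrow> (nat \<Rightarrow> rat) \<Rightarrow> nat \<Rightarrow> rat" where
  "mat_app v A x = (\<lambda>i. \<Sum>j<v. A i j * x j)"

lemma dot_mat_app_adjoint: "dot v (mat_app v A x) y = dot v x (mat_app v (\<lambda>i j. A j i) y)"
  unfolding dot_def mat_app_def sum_distrib_left sum_distrib_right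
  by (subst sum.swap) (simp add: mult_ac)

lemma sum_mat_app:
  assumes "\<And>j. j < v \<Longrightarrow> (\<Sum>i<v. A i j) = k"
  shows "(\<Sum>i<v. mat_app v A x i) = k * (\<Sum>j<v. x j)"
proof -
  have "(\<Sum>i<v. mat_app v A x i) = (\<Sum>j<v. (\<Sum>i<v. A i j) * x j)"
    unfolding mat_app_def sum_distrib_right by (rule sum.swap)
  thus ?thesis using assms by (simp add: sum_distrib_left)
qed

text \<open>The hypothesis says that the transpose of \<open>A\<close> times \<open>A\<close> is
  \<open>n * I + l * J\<close>. On vectors with coordinate sum 0 the \<open>J\<close> term vanishes
  and \<open>A\<close> scales the form by \<open>n\<close>.\<close>

lemma dot_mat_app_gram:
  assumes "\<And>i j. i < v \<Longrightarrow> j < v \<Longrightarrow> (\<Sum>h<v. A h i * A h j) = (if i = j then n else 0) + l"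
  shows "dot v (mat_app v A x) (mat_app v A y) = n * dot v x y + l * (\<Sum>i<v. x i) * (\<Sum>i<v. y i)"
proof -
  have app: "mat_app v (\<lambda>i j. A j i) (mat_app v A y) i = n * y i + l * (\<Sum>j<v. y j)" if "i < v" for i
  proof -
    have "mat_app v (\<lambda>i j. A j i) (mat_app v A y) i = (\<Sum>j<v. (\<Sum>h<v. A h i * A h j) * y j)"
      unfolding mat_app_def sum_distrib_left sum_distrib_right
      by (subst sum.swap) (simp add: mult_ac)
    also have "\<dots> = (\<Sum>j<v. (if i = j then n * y j else 0) + l * y j)"
      using assms that by (intro sum.cong) (auto simp: algebra_simps)
    also have "\<dots> = n * y i + l * (\<Sum>j<v. y j)"
      using that by (simp add: sum.distrib sum_distrib_left)
    finally show ?thesis .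
  qed
  have "dot v (mat_app v A x) (mat_app v A y) = (\<Sum>i<v. x i * (n * y i + l * (\<Sum>j<v. y j)))"
    unfolding dot_mat_app_adjoint by (simp add: dot_def app)
  also have "\<dots> = n * dot v x y + l * (\<Sum>i<v. x i) * (\<Sum>i<v. y i)"
    by (simp add: dot_def algebra_simps sum.distrib flip: sum_distrib_left sum_distrib_right)
  finally show ?thesis .
qed

lemma sum_zero_one:
  fixes f :: "nat \<Rightarrow> int"
  assumes "\<And>j. j < v \<Longrightarrow> f j \<in> {0, 1}"
  shows "(\<Sum>j<v. f j) = int (card {j. j < v \<and> f j = 1})"
proof -
  have "(\<Sum>j<v. f j) = (\<Sum>j<v. if f j = 1 then 1 else 0)"
    using assms by (intro sum.cong) auto
  also have "\<dots> = int (card ({..<v} \<inter> {j. f j = 1}))" by (simp add: sum.If_cases)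
  also have "{..<v} \<inter> {j. f j = 1} = {j. j < v \<and> f j = 1}" by auto
  finally show ?thesis .
qed

definition rat_entries :: "int mat \<Rightarrow> nat \<Rightarrow> nat \<Rightarrow> rat" where
  "rat_entries M i j = of_int (M $$ (i, j))"

lemma symmetric_design_row_sum:
  assumes "symmetric_design_matrix v k l M" "i < v"
  shows "(\<Sum>j<v. rat_entries M i j) = of_nat k"
proof -
  have "(\<Sum>j<v. M $$ (i, j)) = int k"
    using assms sum_zero_one[of v "\<lambda>j. M $$ (i, j)"] by (simp add: symmetric_design_matrix_def)
  thus ?thesis by (simp add: rat_entries_def flip: of_int_sum)
qed

lemma symmetric_design_gram:
  assumes "symmetric_design_matrix v k l M" "i < v" "j < v"
  shows "(\<Sum>h<v. rat_entries M i h * rat_entries M j h) = (if i = j then of_nat k - of_nat l else 0) + of_nat l"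
proof -
  have M: "M \<in> carrier_mat v v" using assms by (simp add: symmetric_design_matrix_def)
  have "(M * transpose_mat M) $$ (i, j) = ((int k - int l) \<cdot>\<^sub>m 1\<^sub>m v + int l \<cdot>\<^sub>m mat v v (\<lambda>_. 1)) $$ (i, j)"
    using assms by (simp add: symmetric_design_matrix_def)
  hence "(\<Sum>h<v. M $$ (i, h) * M $$ (j, h)) = (if i = j then int k - int l else 0) + int l"
    using M assms(2,3) by (auto simp: scalar_prod_def atLeast0LessThan split: if_splits)
  hence "rat_of_int (\<Sum>h<v. M $$ (i, h) * M $$ (j, h)) = of_int ((if i = j then int k - int l else 0) + int l)"
    by (rule arg_cong)
  thus ?thesis by (simp add: rat_entries_def split: if_splits)
qed

lemma symmetric_design_transpose:
  assumes "symmetric_design_matrix v k l M"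
  shows "symmetric_design_matrix v k l (transpose_mat M)"
  using assms by (auto simp: symmetric_design_matrix_def cong: conj_cong) metis

lemma rat_entries_transpose:
  assumes "symmetric_design_matrix v k l M" "i < v" "j < v"
  shows "rat_entries (transpose_mat M) i j = rat_entries M j i"
  using assms by (auto simp: symmetric_design_matrix_def rat_entries_def)

lemma symmetric_design_col_sum:
  assumes "symmetric_design_matrix v k l M" "j < v"
  shows "(\<Sum>i<v. rat_entries M i j) = of_nat k"
  using symmetric_design_row_sum[OF symmetric_design_transpose[OF assms(1)] assms(2)]
  by (simp add: rat_entries_transpose[OF assms(1)] assms(2))

lemma symmetric_design_col_gram:
  assumes "symmetric_design_matrix v k l M" "i < v" "j < v"
  shows "(\<Sum>h<v. rat_entries M h i * rat_entries M h j) = (if i = j then of_nat k - of_nat l else 0) + of_nat l"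
  using symmetric_design_gram[OF symmetric_design_transpose[OF assms(1)] assms(2,3)]
  by (simp add: rat_entries_transpose[OF assms(1)] assms(2,3))

text \<open>The norm of \<open>M\<close> applied to the all-ones vector, computed from the row sums
  and from the Gram matrix; then \<open>v\<close> is cancelled.\<close>

lemma symmetric_design_parameters:
  assumes M: "symmetric_design_matrix v k l M" and "v > 0"
  shows "rat_of_nat k ^ 2 = of_nat k + of_nat l * (of_nat v - 1)"
proof -
  have "dot v (mat_app v (rat_entries M) (\<lambda>_. 1)) (mat_app v (rat_entries M) (\<lambda>_. 1))
      = of_nat v * of_nat k ^ 2"
    by (simp add: dot_def mat_app_def symmetric_design_row_sum[OF M] power2_eq_square)
  moreover have "dot v (mat_app v (rat_entries M) (\<lambda>_. 1)) (mat_app v (rat_entries M) (\<lambda>_. 1))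
      = (of_nat k - of_nat l) * of_nat v + of_nat l * of_nat v * of_nat v"
    using dot_mat_app_gram[OF symmetric_design_col_gram[OF M], of "\<lambda>_. 1" "\<lambda>_. 1"]
    by (simp add: dot_def)
  ultimately have "rat_of_nat v * of_nat k ^ 2 = of_nat v * (of_nat k + of_nat l * (of_nat v - 1))"
    by (simp add: algebra_simps)
  thus ?thesis using \<open>v > 0\<close> by simp
qed

text \<open>The map is \<open>M2\<close> times the transpose of \<open>M1\<close>, plus the
  identity. Expanding the product of two images, the main term gives \<open>n1 * n2\<close>, the
  identity gives 1, and the mixed terms are known because \<open>M1 + M2\<close> is itself a
  design.\<close>

lemma design_sum_similitude:
  assumes M: "symmetric_design_matrix v k l M" and M1: "symmetric_design_matrix v k1 l1 M1"
    and M2: "symmetric_design_matrix v k2 l2 M2" and MM: "M = M1 + M2"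
    and n: "n = of_nat k - of_nat l" "n1 = of_nat k1 - of_nat l1" "n2 = of_nat k2 - of_nat l2"
  shows "similitude_on_perp v (n1 * n2 + (n - n1 - n2) + 1) 1 (\<lambda>_ _. 1)
    (\<lambda>x i. mat_app v (rat_entries M2) (mat_app v (\<lambda>i j. rat_entries M1 j i) x) i + x i)"
proof -
  define T where "T M = mat_app v (\<lambda>i j. rat_entries M j i)" for M
  define A where "A = mat_app v (rat_entries M2)"
  have ones: "dot v (\<lambda>_. 1) x = (\<Sum>i<v. x i)" for x by (simp add: dot_def)
  have T_gram: "dot v (T M x) (T M y) = (of_nat k - of_nat l) * dot v x y"
    if "symmetric_design_matrix v k l M" "(\<Sum>i<v. x i) = 0" for k l M x y
    using dot_mat_app_gram[of v "\<lambda>i j. rat_entries M j i", OF symmetric_design_gram[OF that(1)], of x y] that(2)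
    by (simp add: T_def)
  have T_sum: "(\<Sum>i<v. T M1 x i) = 0" if "(\<Sum>i<v. x i) = 0" for x
    using sum_mat_app[of v "\<lambda>i j. rat_entries M1 j i", OF symmetric_design_row_sum[OF M1], of x] that
    by (simp add: T_def)
  have A_gram: "dot v (A x) (A y) = n2 * dot v x y" if "(\<Sum>i<v. x i) = 0" for x y
    using dot_mat_app_gram[of v "rat_entries M2", OF symmetric_design_col_gram[OF M2], of x y] that
    by (simp add: A_def n)
  have A_sum: "(\<Sum>i<v. A x i) = 0" if "(\<Sum>i<v. x i) = 0" for x
    using sum_mat_app[of v "rat_entries M2", OF symmetric_design_col_sum[OF M2], of x] that
    by (simp add: A_def)
  have A_adj: "dot v (A x) y = dot v x (T M2 y)" for x y
    unfolding A_def T_def by (rule dot_mat_app_adjoint)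
  have dims: "M1 \<in> carrier_mat v v" "M2 \<in> carrier_mat v v"
    using M1 M2 by (simp_all add: symmetric_design_matrix_def)
  have T_add: "T M x i = T M1 x i + T M2 x i" if "i < v" for x i
    using that dims unfolding T_def mat_app_def MM
    by (simp add: rat_entries_def algebra_simps sum.distrib)
  \<comment> \<open>Polarization: expand the Gram relation of \<open>M = M1 + M2\<close> and
    subtract those of \<open>M1\<close> and \<open>M2\<close>.\<close>
  have cross: "dot v (T M1 x) (T M2 y) + dot v (T M1 y) (T M2 x) = (n - n1 - n2) * dot v x y"
    if x: "(\<Sum>i<v. x i) = 0" for x y
  proof -
    have "dot v (T M x) (T M y) = dot v (\<lambda>i. T M1 x i + T M2 x i) (\<lambda>i. T M1 y i + T M2 y i)"
      by (simp add: dot_def T_add)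
    also have "\<dots> = dot v (T M1 x) (T M1 y) + dot v (T M2 x) (T M2 y)
        + (dot v (T M1 x) (T M2 y) + dot v (T M1 y) (T M2 x))"
      unfolding dot_linear by (simp add: dot_commute[of v "T M2 x" "T M1 y"])
    finally show ?thesis
      unfolding T_gram[OF M x] T_gram[OF M1 x] T_gram[OF M2 x] n by (simp add: algebra_simps)
  qed
  have "dot v (\<lambda>i. A (T M1 x) i + x i) (\<lambda>i. A (T M1 y) i + y i)
      = (n1 * n2 + (n - n1 - n2) + 1) * dot v x y"
    if x: "(\<Sum>i<v. x i) = 0" for x y
  proof -
    have "dot v (\<lambda>i. A (T M1 x) i + x i) (\<lambda>i. A (T M1 y) i + y i)
        = dot v (A (T M1 x)) (A (T M1 y))
          + (dot v (A (T M1 x)) y + dot v (A (T M1 y)) x) + dot v x y"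
      unfolding dot_linear by (simp add: dot_commute[of v x "A (T M1 y)"])
    also have "dot v (A (T M1 x)) (A (T M1 y)) = n2 * (n1 * dot v x y)"
      using A_gram[OF T_sum[OF x]] T_gram[OF M1 x] by (simp add: n)
    also have "dot v (A (T M1 x)) y + dot v (A (T M1 y)) x = (n - n1 - n2) * dot v x y"
      unfolding A_adj by (rule cross[OF x])
    finally show ?thesis by (simp add: algebra_simps)
  qed
  moreover have "(\<Sum>i<v. A (T M1 x) i + x i) = 0" if "(\<Sum>i<v. x i) = 0" for x
    using A_sum[OF T_sum[OF that]] that by (simp add: sum.distrib)
  ultimately show ?thesis
    unfolding similitude_on_perp_def ones
    by (simp flip: A_def T_def)
qed

text \<open>A rational square root of an integer is an integer: writing it as \<open>a / b\<close>,
  \<open>b ^ 2\<close> divides \<open>a ^ 2\<close>, hence \<open>b\<close> divides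
  \<open>a\<close>.\<close>

lemma of_int_eq_rat_square:
  assumes "of_int s = (c :: rat) ^ 2"
  obtains t where "s = t ^ 2"
proof -
  obtain a b where c: "c = of_int a / of_int b" "b \<noteq> 0" by (rule rat_fraction)
  have "rat_of_int (s * b ^ 2) = of_int (a ^ 2)"
    using assms c by (simp add: field_simps)
  hence eq: "s * b ^ 2 = a ^ 2" by (simp only: of_int_eq_iff)
  hence "b ^ 2 dvd a ^ 2" by (metis dvd_triv_right)
  hence "b dvd a" by simp
  then obtain t where "a = b * t" by blast
  hence "s = t ^ 2" using eq c(2) by (simp add: power_mult_distrib)
  thus thesis by (rule that)
qed

text \<open>Row sums give \<open>k = k1 + k2\<close>, so \<open>2 * k1 * k2\<close> is
  \<open>k ^ 2 - k1 ^ 2 - k2 ^ 2\<close>, and the parameter equations turn this into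
  \<open>(n1 + n2 - n) * (v - 1)\<close>. In particular \<open>\<sigma>\<close> is an
  integer.\<close>

lemma design_sum_sigma:
  assumes v: "v \<ge> 2" and M: "symmetric_design_matrix v k l M"
    and M1: "symmetric_design_matrix v k1 l1 M1" and M2: "symmetric_design_matrix v k2 l2 M2"
    and MM: "M = M1 + M2"
    and \<sigma>: "\<sigma> = (of_nat k1 - of_nat l1) * (of_nat k2 - of_nat l2)
              - 2 * of_nat k1 * of_nat k2 / (of_nat v - 1) + 1"
    and n: "n = of_nat k - of_nat l" "n1 = of_nat k1 - of_nat l1" "n2 = of_nat k2 - of_nat l2"
  shows "\<sigma> = n1 * n2 + (n - n1 - n2) + (1 :: rat)"
proof -
  have dims: "M1 \<in> carrier_mat v v" "M2 \<in> carrier_mat v v"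
    using M1 M2 by (simp_all add: symmetric_design_matrix_def)
  have "(\<Sum>j<v. rat_entries M 0 j) = (\<Sum>j<v. rat_entries M1 0 j) + (\<Sum>j<v. rat_entries M2 0 j)"
    using dims v by (simp add: MM rat_entries_def sum.distrib)
  hence k: "rat_of_nat k = of_nat k1 + of_nat k2"
    using v symmetric_design_row_sum[OF M, of 0] symmetric_design_row_sum[OF M1, of 0]
      symmetric_design_row_sum[OF M2, of 0] by simp
  have "2 * rat_of_nat k1 * of_nat k2 = of_nat k ^ 2 - of_nat k1 ^ 2 - of_nat k2 ^ 2"
    by (simp add: k power2_eq_square algebra_simps)
  also have "\<dots> = (n1 + n2 - n) * (of_nat v - 1)"
    using v symmetric_design_parameters[OF M] symmetric_design_parameters[OF M1]
      symmetric_design_parameters[OF M2] by (simp add: n k algebra_simps)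
  finally have "2 * rat_of_nat k1 * of_nat k2 / (of_nat v - 1) = n1 + n2 - n"
    using v by (simp add: field_simps)
  thus ?thesis unfolding \<sigma> n by simp
qed

theorem theorem4p10:
  fixes v k l k1 l1 k2 l2 :: nat and M M1 M2 :: "int mat" and \<sigma> :: rat
  assumes "v \<ge> 2"
    and "symmetric_design_matrix v k l M"
    and "symmetric_design_matrix v k1 l1 M1"
    and "symmetric_design_matrix v k2 l2 M2"
    and "M = M1 + M2"
    and "\<sigma> = (of_nat k1 - of_nat l1) * (of_nat k2 - of_nat l2)
              - 2 * of_nat k1 * of_nat k2 / (of_nat v - 1) + 1"
  shows "(even v \<longrightarrow> (\<exists>s::int. \<sigma> = of_int (s ^ 2))) \<and>
         (odd v \<and> \<sigma> \<noteq> 0 \<longrightarrow>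
           (\<forall>p::nat. prime p \<and> odd p \<longrightarrow>
              hilbert_symbol p \<sigma> \<sigma> ^ ((v - 1) choose 2) * hilbert_symbol p \<sigma> (of_nat v)
                = hilbert_symbol p \<sigma> ((- 1) ^ ((v - 1) div 2) * of_nat v) \<and>
              hilbert_symbol p \<sigma> ((- 1) ^ ((v - 1) div 2) * of_nat v) = 1))"
proof -
  define n n1 n2 :: int where "n = int k - int l" "n1 = int k1 - int l1" "n2 = int k2 - int l2"
  note n = this
  have \<sigma>: "\<sigma> = of_int n1 * of_int n2 + (of_int n - of_int n1 - of_int n2) + 1"
    by (rule design_sum_sigma[OF assms]) (simp_all add: n)
  have sim: "similitude_on_perp v \<sigma> 1 (\<lambda>_ _. 1)
      (\<lambda>x i. mat_app v (rat_entries M2) (mat_app v (\<lambda>i j. rat_entries M1 j i) x) i + x i)"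
    unfolding \<sigma> by (rule design_sum_similitude[OF assms(2-5)]) (simp_all add: n)
  have orth: "orthogonal_system v 1 (\<lambda>_ _. 1)"
    using assms(1) by (simp add: orthogonal_system_def dot_def)
  define b :: rat where "b = (- 1) ^ ((v - 1) div 2) * of_nat v"
  \<comment> \<open>Either \<open>\<sigma>\<close> is a rational square (0 included), or the
    similitude argument, started from the all-ones vector of norm \<open>v\<close>, applies.\<close>
  have *: "(\<exists>c. \<sigma> = c ^ 2) \<or> (odd v \<and> (\<exists>x y z. y \<noteq> 0 \<and> \<sigma> * x ^ 2 + b * y ^ 2 = z ^ 2))"
  proof (cases "\<exists>c. \<sigma> = c ^ 2")
    case False
    moreover from this have "\<sigma> \<noteq> 0" by (metis zero_power2)
    ultimately show ?thesis
      using similitude_norm[OF orth sim] by (auto simp: b_def dot_def)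
  qed simp
  have "\<exists>s::int. \<sigma> = of_int (s ^ 2)" if ev: "even v"
  proof -
    obtain c where "\<sigma> = c ^ 2" using * ev by blast
    hence "of_int (n1 * n2 + (n - n1 - n2) + 1) = c ^ 2" unfolding \<sigma> by simp
    then obtain t where "n1 * n2 + (n - n1 - n2) + 1 = t ^ 2" by (rule of_int_eq_rat_square)
    hence "rat_of_int (n1 * n2 + (n - n1 - n2) + 1) = of_int (t ^ 2)" by (rule arg_cong)
    thus ?thesis unfolding \<sigma> by auto
  qed
  moreover have "hilbert_symbol p \<sigma> \<sigma> ^ ((v - 1) choose 2) * hilbert_symbol p \<sigma> (of_nat v) = 1
      \<and> hilbert_symbol p \<sigma> b = 1"
    if "odd v" "\<sigma> \<noteq> 0" and p: "prime p" for p
  proof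
    have "\<exists>x y z. \<not> (x = 0 \<and> y = 0 \<and> z = 0) \<and> \<sigma> * x ^ 2 + b * y ^ 2 = z ^ 2"
      using *
    proof
      assume "\<exists>c. \<sigma> = c ^ 2"
      \<comment> \<open>For a square \<open>\<sigma>\<close> the point \<open>(1, 0, c)\<close> is a
        solution whatever \<open>b\<close> is.\<close>
      then obtain c where "\<sigma> * 1 ^ 2 + b * 0 ^ 2 = c ^ 2" by auto
      thus ?thesis by (metis zero_neq_one)
    qed blast
    thus b: "hilbert_symbol p \<sigma> b = 1" using hilbert_symbol_eq_1I[OF p] by blast
    obtain m where m: "v = 2 * m + 1" using \<open>odd v\<close> by (elim oddE)
    have "(v - 1) choose 2 = m * (2 * m - 1)" by (simp add: m choose_two)
    \<comment> \<open>The factor \<open>2 * m - 1\<close> is odd, so the exponent has the parity of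
      \<open>m\<close>, which is also the exponent of the sign in \<open>b\<close>.\<close>
    hence parity: "even ((v - 1) choose 2) \<longleftrightarrow> even m" using assms(1) m by (cases m) auto
    have sq: "hilbert_symbol p x y * hilbert_symbol p x y = 1" for x y
      using hilbert_symbol_values[of p x y] by auto
    show "hilbert_symbol p \<sigma> \<sigma> ^ ((v - 1) choose 2) * hilbert_symbol p \<sigma> (of_nat v) = 1"
    proof (cases "even m")
      case True
      moreover have "hilbert_symbol p \<sigma> \<sigma> ^ ((v - 1) choose 2) = 1"
        using True hilbert_symbol_values[of p \<sigma> \<sigma>] parity by auto
      ultimately show ?thesis using b m by (simp add: b_def)
    next
      case False
      \<comment> \<open>For odd \<open>m\<close>, \<open>b = - v\<close> is a norm, so the symbols
        of \<open>\<sigma>\<close> with \<open>\<sigma>\<close>, with \<open>-1\<close> and with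
        \<open>v\<close> coincide, and the product is the square of a sign.\<close>
      hence "hilbert_symbol p \<sigma> (- of_nat v) = 1" using b by (simp add: b_def m)
      hence "hilbert_symbol p \<sigma> \<sigma> = hilbert_symbol p \<sigma> (of_nat v)"
        using hilbert_symbol_self[OF p \<open>\<sigma> \<noteq> 0\<close>] hilbert_symbol_minus_one[OF p, of "of_nat v"] assms(1)
        by simp
      moreover have "hilbert_symbol p \<sigma> \<sigma> ^ ((v - 1) choose 2) = hilbert_symbol p \<sigma> \<sigma>"
        using False hilbert_symbol_values[of p \<sigma> \<sigma>] parity by auto
      ultimately show ?thesis by (simp add: sq)
    qed
  qed
  ultimately show ?thesis unfolding b_def by metis
qed

end
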